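(* Let $r$ be a positive integer and let the derangement polynomials of order $r$, $d_{n}^{(r)}(x)$, be defined by $\frac{e^{xz}}{(1-z)^{r}}=\sum_{n\geq0}d_{n}^{(r)}(x)\frac{z^{n}}{n!}$. Then for every integer $n\ge0$, \[\det\left(d_{i+j-2}^{(r)}(z)\right)_{1\leq i,j\leq n+1}=r^{\overline{n}}\prod_{k=1}^{n}r^{\overline{k-1}}\,k!,\] where $r^{\overline{k}}=r(r+1)\cdots(r+k-1)$ and $r^{\overline{0}}=1$.
   Context: The generating function identity is an identity of formal power series in $z$; equivalently $d_{n}^{(r)}(x)=\sum_{k=0}^{n}\binom{n}{k}r^{\overline{k}}x^{n-k}$. *)

theory Defs
  imports
    "Jordan_Normal_Form.Determinant"
    "HOL-Computational_Algebra.Formal_Power_Series"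
begin

text \<open>
  The generating function is a power series in \<open>z\<close> (\<open>fps_X\<close>) whose coefficients are
  polynomials in \<open>x\<close> (\<open>[:0, 1:]\<close>).
  Division and \<open>fps_exp\<close> for formal power series require a field of coefficients, so over the
  polynomial ring \<open>exp (x * z)\<close> is written out, and \<open>1 / (1 - z) ^ r\<close> is the library's
  inverse over general rings; its second argument is the inverse of the constant coefficient,
  here \<open>1\<close>.
\<close>

definition exp_xz :: "'a::field_char_0 poly fps" where
  "exp_xz = Abs_fps (\<lambda>n. smult (1 / fact n) ([:0, 1:] ^ n))"

definition derangement_gf :: "nat \<Rightarrow> 'a::field_char_0 poly fps" where
  "derangement_gf r = exp_xz * fps_right_inverse ((1 - fps_X) ^ r) 1"

definition derangement_poly :: "nat \<Rightarrow> nat \<Rightarrow> 'a::field_char_0 poly" where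
  "derangement_poly r n = smult (fact n) (fps_nth (derangement_gf r) n)"

lemma derangement_gf_mult:
  "Abs_fps (\<lambda>n. smult (1 / fact n) (derangement_poly r n)) * (1 - fps_X) ^ r
     = (exp_xz :: 'a::field_char_0 poly fps)"
proof -
  have gf: "Abs_fps (\<lambda>n. smult (1 / fact n) (derangement_poly r n))
      = (derangement_gf r :: 'a poly fps)"
    by (rule fps_ext) (simp add: derangement_poly_def)
  have "(1 - fps_X) ^ r * fps_right_inverse ((1 - fps_X) ^ r) 1 = (1 :: 'a poly fps)"
    by (rule fps_right_inverse) (simp add: fps_nth_power_0)
  then show ?thesis
    unfolding gf derangement_gf_def by (simp add: mult.assoc mult.commute)
qed

text \<open>Evaluated at a scalar, this is the identity in terms of \<open>fps_exp\<close> and division.\<close>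

lemma derangement_gf_eval:
  fixes x :: "'a::field_char_0"
  shows "Abs_fps (\<lambda>n. poly (derangement_poly r n) x / fact n) = fps_exp x / (1 - fps_X) ^ r"
proof -
  define ev where "ev = (\<lambda>F :: 'a poly fps. Abs_fps (\<lambda>n. poly (fps_nth F n) x))"
  have ev_mult: "ev (F * G) = ev F * ev G" for F G
    by (rule fps_ext) (simp add: ev_def fps_mult_nth poly_sum)
  have ev_X: "ev (1 - fps_X) = 1 - fps_X"
    by (rule fps_ext) (auto simp: ev_def fps_X_def)
  have ev_one: "ev 1 = 1"
    by (rule fps_ext) (auto simp: ev_def)
  have ev_pow: "ev ((1 - fps_X) ^ k) = (1 - fps_X) ^ k" for k
    by (induction k) (simp_all add: ev_one ev_mult ev_X)
  have ev_exp: "ev exp_xz = fps_exp x"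
    by (rule fps_ext) (simp add: ev_def exp_xz_def fps_exp_def)
  have ev_d: "ev (Abs_fps (\<lambda>n. smult (1 / fact n) (derangement_poly r n)))
      = Abs_fps (\<lambda>n. poly (derangement_poly r n) x / fact n)"
    by (rule fps_ext) (simp add: ev_def)
  have "Abs_fps (\<lambda>n. poly (derangement_poly r n) x / fact n) * (1 - fps_X) ^ r = fps_exp x"
    using arg_cong[OF derangement_gf_mult, of ev r] by (simp add: ev_mult ev_pow ev_exp ev_d)
  moreover have "(1 - fps_X) ^ r \<noteq> (0 :: 'a fps)"
  proof -
    have "fps_nth ((1 - fps_X) ^ r :: 'a fps) 0 = 1"
      by (simp add: fps_nth_power_0)
    then show ?thesis
      by force
  qed
  ultimately show ?thesis
    by (metis nonzero_mult_div_cancel_right)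
qed

end

theory Submission
  imports Defs
begin

text \<open>
  Let \<open>F\<close> be the generating function and \<open>V = 1 / (1 - z)\<close>. Since \<open>V' = V\<^sup>2\<close>, the series
  \<open>F * (V - 1) ^ k\<close> are related by a three-term differential recurrence, so that
  the polynomials \<open>d\<^sub>n\<close> form the first column of a Stieltjes table: each row arises from the
  previous one by a tridiagonal (Jacobi) matrix, with off-diagonal products
  \<open>l k = (k + 1) * (r + k)\<close>. A tridiagonal matrix is self-adjoint for a suitable weight, which
  factors the Hankel matrix of such a column as \<open>L D L\<^sup>T\<close> with \<open>L\<close> unitriangular.
\<close>

text \<open>Each row step extends the support by at most one column to the right, and it does so
  with coefficient 1.\<close>

lemma stieltjes_table_triangular:
  fixes a :: "nat \<Rightarrow> nat \<Rightarrow> 'b::comm_ring_1"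
  assumes init: "\<And>k. a 0 k = (if k = 0 then 1 else 0)"
    and step_0: "\<And>n. a (Suc n) 0 = b 0 * a n 0 + l 0 * a n 1"
    and step_Suc: "\<And>n k. a (Suc n) (Suc k)
      = a n k + b (Suc k) * a n (Suc k) + l (Suc k) * a n (Suc (Suc k))"
  shows "n < k \<Longrightarrow> a n k = 0" and "a n n = 1"
proof -
  show zero: "n < k \<Longrightarrow> a n k = 0" for n k
  proof (induction n arbitrary: k)
    case 0
    then show ?case by (simp add: init)
  next
    case (Suc n)
    then obtain k' where "k = Suc k'" "n < k'"
      by (cases k) auto
    then show ?case by (simp add: step_Suc Suc.IH)
  qed
  show "a n n = 1"
    by (induction n) (simp_all add: init step_Suc zero)
qed

text \<open>By self-adjointness, the weighted pairing of two rows is unchanged when one row step is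
  moved from the second row to the first. Once all steps are moved, the second row is the unit
  vector \<open>a 0\<close>, which picks out column 0.\<close>

lemma stieltjes_table_addition:
  fixes a :: "nat \<Rightarrow> nat \<Rightarrow> 'b::comm_ring_1"
  assumes init: "\<And>k. a 0 k = (if k = 0 then 1 else 0)"
    and step_0: "\<And>n. a (Suc n) 0 = b 0 * a n 0 + l 0 * a n 1"
    and step_Suc: "\<And>n k. a (Suc n) (Suc k)
      = a n k + b (Suc k) * a n (Suc k) + l (Suc k) * a n (Suc (Suc k))"
    and "i \<le> N" "j \<le> N"
  shows "(\<Sum>k\<le>N. (\<Prod>m<k. l m) * a i k * a j k) = a (i + j) 0"
proof -
  note zero = stieltjes_table_triangular(1)[of a b l, OF init step_0 step_Suc]
  define w where "w k = (\<Prod>m<k. l m)" for k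
  define S where "S M i j = (\<Sum>k\<le>M. w k * a i k * a j k)" for M i j
  \<comment> \<open>The \<open>b\<close> terms cancel, and since
    \<open>w (Suc k) = w k * l k\<close> the off-diagonal terms telescope; only the coupling across
    the cut between columns \<open>M\<close> and \<open>M + 1\<close> survives.\<close>
  have boundary: "S M (Suc i) j - S M i (Suc j)
      = w (Suc M) * (a i (Suc M) * a j M - a i M * a j (Suc M))" for M i j
    unfolding S_def
    by (induction M) (simp_all add: step_0 step_Suc w_def algebra_simps)
  have shift: "S M (Suc i) j = S M i (Suc j)" if "i \<le> M" "j \<le> M" for M i j
    using boundary[of M i j] that by (simp add: zero)
  have total: "S M i j = a (i + j) 0" if "i + j \<le> M" for M i j
    using that
  proof (induction j arbitrary: i)
    case 0
    have "S M i 0 = (\<Sum>k\<le>M. if k = 0 then a i 0 else 0)"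
      unfolding S_def by (rule sum.cong) (auto simp: init w_def)
    then show ?case by simp
  next
    case (Suc j)
    then show ?case using shift[of i M j] by simp
  qed
  \<comment> \<open>Moving steps raises the first row index up to \<open>i + j\<close>, so the cut
    must lie at least that far right; the added terms vanish because row \<open>i\<close> ends at
    column \<open>i\<close>.\<close>
  have "S N i j = S (i + j + N) i j"
    unfolding S_def
    by (rule sum.mono_neutral_left) (use \<open>i \<le> N\<close> in \<open>auto simp: zero\<close>)
  also have "\<dots> = a (i + j) 0"
    by (rule total) simp
  finally show ?thesis
    by (simp add: S_def w_def)
qed

theorem det_hankel_stieltjes_table:
  fixes a :: "nat \<Rightarrow> nat \<Rightarrow> 'b::comm_ring_1"
  assumes init: "\<And>k. a 0 k = (if k = 0 then 1 else 0)"
    and step_0: "\<And>n. a (Suc n) 0 = b 0 * a n 0 + l 0 * a n 1"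
    and step_Suc: "\<And>n k. a (Suc n) (Suc k)
      = a n k + b (Suc k) * a n (Suc k) + l (Suc k) * a n (Suc (Suc k))"
  shows "det (mat (n + 1) (n + 1) (\<lambda>(i, j). a (i + j) 0)) = (\<Prod>k\<le>n. \<Prod>m<k. l m)"
proof -
  note triangular = stieltjes_table_triangular[of a b l, OF init step_0 step_Suc]
  define w where "w k = (\<Prod>m<k. l m)" for k
  define A where "A = mat (n + 1) (n + 1) (\<lambda>(i, k). a i k)"
  \<comment> \<open>The weight goes into the second factor: \<open>A\<close> is the unitriangular L,
    and \<open>B\<close> is D times the transpose of L.\<close>
  define B where "B = mat (n + 1) (n + 1) (\<lambda>(k, j). w k * a j k)"
  have A: "A \<in> carrier_mat (n + 1) (n + 1)" and B: "B \<in> carrier_mat (n + 1) (n + 1)"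
    by (simp_all add: A_def B_def)
  have "mat (n + 1) (n + 1) (\<lambda>(i, j). a (i + j) 0) = A * B"
  proof (rule eq_matI)
    fix i j
    assume "i < dim_row (A * B)" "j < dim_col (A * B)"
    then have ij: "i \<le> n" "j \<le> n"
      by (simp_all add: A_def B_def)
    have "(A * B) $$ (i, j) = (\<Sum>k = 0..<n + 1. a i k * (w k * a j k))"
      using ij by (simp add: A_def B_def scalar_prod_def)
    also have "\<dots> = (\<Sum>k\<le>n. w k * a i k * a j k)"
      by (rule sum.cong) (auto simp: ac_simps)
    also have "\<dots> = a (i + j) 0"
      unfolding w_def
      by (rule stieltjes_table_addition[of a b l, OF init step_0 step_Suc ij])
    finally show "mat (n + 1) (n + 1) (\<lambda>(i, j). a (i + j) 0) $$ (i, j) = (A * B) $$ (i, j)"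
      using ij by simp
  qed (simp_all add: A_def B_def)
  moreover have "det A = 1"
    by (subst det_lower_triangular[OF _ A]) (auto simp: A_def triangular prod_list_diag_prod)
  moreover have "det B = (\<Prod>k\<le>n. w k)"
  proof -
    have "upper_triangular B"
      by (auto simp: upper_triangular_def B_def triangular)
    then have "det B = prod_list (diag_mat B)"
      by (rule det_upper_triangular[OF _ B])
    also have "\<dots> = (\<Prod>k = 0..<n + 1. w k)"
      by (simp add: prod_list_diag_prod B_def triangular)
    also have "{0..<n + 1} = {..n}"
      by auto
    finally show ?thesis .
  qed
  ultimately show ?thesis
    using det_mult[OF A B] by (simp add: w_def)
qed

text \<open>The series 1 / (1 - z), given by coefficients because division would require them to lie
  in a field.\<close>

definition geometric_fps :: "'a::comm_ring_1 fps" where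
  "geometric_fps = Abs_fps (\<lambda>_. 1)"

lemma geometric_fps_mult: "(1 - fps_X) * geometric_fps = 1"
proof (rule fps_ext)
  show "fps_nth ((1 - fps_X) * geometric_fps) n = fps_nth (1 :: 'a fps) n" for n
    by (cases n) (simp_all add: geometric_fps_def algebra_simps)
qed

text \<open>Differentiating (1 - z) V = 1 gives (1 - z) V' = V; multiplying by V then removes the
  factor 1 - z.\<close>

lemma fps_deriv_geometric_fps:
  "fps_deriv geometric_fps = (geometric_fps ^ 2 :: 'a::comm_ring_1 fps)"
proof -
  let ?V = "geometric_fps :: 'a fps"
  have "(1 - fps_X) * fps_deriv ?V = ?V"
    using arg_cong[OF geometric_fps_mult[where 'a='a], of fps_deriv] by (simp add: algebra_simps)
  then have "(1 - fps_X) * ?V * fps_deriv ?V = ?V ^ 2"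
    by (simp add: power2_eq_square mult.assoc mult.left_commute)
  then show ?thesis
    by (simp add: geometric_fps_mult)
qed

text \<open>Both factors beside \<open>exp_xz\<close> are inverses of
  \<open>(1 - fps_X) ^ r\<close>, and inverses in a commutative ring are unique.\<close>

lemma derangement_gf_eq: "derangement_gf r = exp_xz * geometric_fps ^ r"
proof -
  let ?I = "fps_right_inverse ((1 - fps_X) ^ r) 1 :: 'a poly fps"
  have "(1 - fps_X) ^ r * ?I = 1"
    by (rule fps_right_inverse) (simp add: fps_nth_power_0)
  moreover have "(1 - fps_X) ^ r * geometric_fps ^ r = (1 :: 'a poly fps)"
    by (simp add: power_mult_distrib[symmetric] geometric_fps_mult)
  ultimately have "?I = geometric_fps ^ r"
    using mult.assoc[of "geometric_fps ^ r" "(1 - fps_X) ^ r" ?I]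
    by (simp add: mult.commute)
  then show ?thesis
    by (simp add: derangement_gf_def)
qed

lemma fps_deriv_exp_xz:
  "fps_deriv exp_xz = fps_const [:0, 1:] * (exp_xz :: 'a::field_char_0 poly fps)"
proof (rule fps_ext)
  fix n
  have "of_nat (n + 1) * smult (1 / fact (n + 1)) p = smult (1 / fact n) p" for p :: "'a poly"
  proof -
    have "of_nat (n + 1) * (1 / fact (n + 1)) = (1 / fact n :: 'a)"
      by (simp add: divide_simps del: of_nat_Suc)
    then show ?thesis
      by (simp only: of_nat_poly mult_pCons_left smult_smult mult_zero_left pCons_0_0 add_0_right)
  qed
  then show "fps_nth (fps_deriv exp_xz) n = fps_nth (fps_const [:0, 1:] * exp_xz :: 'a poly fps) n"
    by (simp add: exp_xz_def del: of_nat_Suc)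
qed

text \<open>Powers of V - 1 = z / (1 - z) are used rather than powers of V: its constant coefficient
  is 0, so only column 0 has a nonzero constant coefficient.\<close>

definition derangement_table :: "nat \<Rightarrow> nat \<Rightarrow> 'a::field_char_0 poly fps" where
  "derangement_table r k = derangement_gf r * (geometric_fps - 1) ^ k"

lemma fps_deriv_derangement_gf:
  "fps_deriv (derangement_gf r)
     = (fps_const [:0, 1:] + of_nat r * geometric_fps) * derangement_gf r"
proof (cases r)
  case 0
  then show ?thesis by (simp add: derangement_gf_eq fps_deriv_exp_xz)
next
  case (Suc s)
  show ?thesis
    unfolding derangement_gf_eq fps_deriv_mult fps_deriv_power fps_deriv_exp_xz
      fps_deriv_geometric_fps fps_of_nat Suc
    by (simp add: power2_eq_square algebra_simps)
qed

text \<open>With U = V - 1, both V = 1 + U and U' = (1 + U)^2 are polynomials in U, and expanding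
  leaves only the powers k - 1, k and k + 1 of U. At \<open>k = 0\<close> the truncated
  \<open>k - 1\<close> is harmless, since its term has the factor \<open>k\<close>.\<close>

lemma fps_deriv_derangement_table:
  "fps_deriv (derangement_table r k)
     = of_nat k * derangement_table r (k - 1)
       + (fps_const [:0, 1:] + of_nat (r + 2 * k)) * derangement_table r k
       + of_nat (r + k) * derangement_table r (Suc k)"
proof (cases k)
  case 0
  then show ?thesis
    by (simp add: derangement_table_def fps_deriv_derangement_gf algebra_simps)
next
  case (Suc m)
  define U :: "'a poly fps" where "U = geometric_fps - 1"
  have V: "geometric_fps = 1 + U"
    by (simp add: U_def)
  have "fps_deriv U = (1 + U) ^ 2"
    by (simp add: U_def fps_deriv_geometric_fps)
  then show ?thesis
    unfolding derangement_table_def U_def[symmetric] fps_deriv_mult fps_deriv_power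
      fps_deriv_derangement_gf fps_of_nat Suc
    by (simp add: V power2_eq_square algebra_simps)
qed

theorem theorem17:
  fixes r n :: nat
  assumes "r > 0"
  shows "det (mat (n + 1) (n + 1)
             (\<lambda>(i, j). derangement_poly r (i + j) :: 'a::field_char_0 poly))
         = of_nat (pochhammer r n * (\<Prod>k=1..n. pochhammer r (k - 1) * fact k))"
proof -
  \<comment> \<open>The factor \<open>fact m\<close> turns differentiation into a shift of
    \<open>m\<close>. Dividing by \<open>fact k\<close> normalises the coefficient \<open>k\<close>
    of column \<open>k - 1\<close> to 1 and moves a factor \<open>k + 1\<close> into
    \<open>l k\<close>.\<close>
  define a :: "nat \<Rightarrow> nat \<Rightarrow> 'a poly" where
    "a m k = smult (fact m / fact k) (fps_nth (derangement_table r k) m)" for m k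
  define b :: "nat \<Rightarrow> 'a poly" where "b k = [:0, 1:] + of_nat (r + 2 * k)" for k
  define l :: "nat \<Rightarrow> 'a poly" where "l k = of_nat (Suc k * (r + k))" for k
  have init: "a 0 k = (if k = 0 then 1 else 0)" for k
    by (simp add: a_def derangement_table_def derangement_gf_eq exp_xz_def geometric_fps_def
        fps_nth_power_0)
  have step: "a (Suc m) k
      = smult (fact m / fact k) (of_nat k * fps_nth (derangement_table r (k - 1)) m
          + b k * fps_nth (derangement_table r k) m
          + of_nat (r + k) * fps_nth (derangement_table r (Suc k)) m)"
    for m k
  proof -
    have "a (Suc m) k = smult (fact m / fact k) (fps_nth (fps_deriv (derangement_table r k)) m)"
      by (simp add: a_def of_nat_poly algebra_simps del: of_nat_Suc)
    then show ?thesis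
      by (simp add: fps_deriv_derangement_table b_def fps_of_nat[symmetric] algebra_simps)
  qed
  have last: "smult (fact m / fact k) (of_nat (r + k) * fps_nth (derangement_table r (Suc k)) m)
      = l k * a m (Suc k)" for m k
    by (simp add: a_def l_def of_nat_poly divide_simps del: of_nat_Suc mult_Suc)
  have first: "smult (fact m / fact (Suc k)) (of_nat (Suc k) * fps_nth (derangement_table r k) m)
      = a m k" for m k
    by (simp add: a_def of_nat_poly divide_simps del: of_nat_Suc)
  have step_0: "a (Suc m) 0 = b 0 * a m 0 + l 0 * a m 1" for m
    using last[of m 0] by (simp only: step smult_add_right) (simp add: a_def)
  have step_Suc: "a (Suc m) (Suc k)
      = a m k + b (Suc k) * a m (Suc k) + l (Suc k) * a m (Suc (Suc k))" for m k
    using first[of m k] last[of m "Suc k"]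
    by (simp only: step smult_add_right diff_Suc_1) (simp add: a_def)
  have prod_l: "(\<Prod>m<k. l m) = of_nat (pochhammer r k * fact k)" for k
    by (induction k) (simp_all add: l_def pochhammer_Suc algebra_simps)
  have "derangement_poly r m = a m 0" for m
    by (simp add: derangement_poly_def a_def derangement_table_def)
  then have "det (mat (n + 1) (n + 1) (\<lambda>(i, j). derangement_poly r (i + j) :: 'a poly))
      = (\<Prod>k\<le>n. \<Prod>m<k. l m)"
    using det_hankel_stieltjes_table[of a b l n, OF init step_0 step_Suc] by simp
  also have "\<dots> = of_nat (\<Prod>k\<le>n. pochhammer r k * fact k)"
    by (simp add: prod_l)
  \<comment> \<open>Splitting off the last rising factorial shifts the index of the remaining ones
    down by one against the factorials.\<close>
  also have "(\<Prod>k\<le>n. pochhammer r k * fact k)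
      = pochhammer r n * (\<Prod>k=1..n. pochhammer r (k - 1) * fact k)"
    by (induction n) (simp_all add: prod.nat_ivl_Suc' ac_simps)
  finally show ?thesis .
qed

end
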